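(* For every $n,s\in\mathbb{N}$, the following relation holds: $$\sup_{\substack{T_n\in\mathcal{T}_{n,\mathrm{c}},\\ \|T_n\|_1^*=1}}\big\|T_n^{(s)}\big\|_\infty^*\asymp\left(n^s+\frac{n^{s+1}}{s+1}\right)\left(\frac{1}{\log(s+2)}+\frac{1}{\log(n+2)}\right).$$
   Context: A finite sequence of real numbers $c=(c_0,\dots,c_n)$ is called concave if, with $c_{n+1}:=0$ and $\Delta c_k:=c_k-c_{k+1}$ for $0\le k\le n$, one has $c_0\ge c_1\ge\dots\ge c_n\ge c_{n+1}=0$ and $\Delta c_n\ge\Delta c_{n-1}\ge\dots\ge\Delta c_0$. $\mathcal{T}_{n,\mathrm{c}}$ is the set of all trigonometric polynomials $T_n(x)=c_0+\sum_{k=1}^n 2c_k\cos kx$ with a concave sequence $c=(c_0,\dots,c_n)$. $\|f\|_1^*:=\int_{-\pi}^{\pi}|f(x)|\,dx$ and $\|f\|_\infty^*:=\sup_{x\in[-\pi,\pi]}|f(x)|$. The notation $A\asymp B$ means that there are absolute constants $C_1,C_2>0$ (independent of $n$ and $s$) such that $C_2B\le A\le C_1B$. *)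

theory Defs
  imports "HOL-Analysis.Analysis"
begin

text \<open>A finite sequence \<open>(c\<^sub>0, \<dots>, c\<^sub>n)\<close> is encoded as \<open>c :: nat \<Rightarrow> real\<close>, of which only the
  values at indices \<open>\<le> n\<close> matter; \<open>zero_ext n c\<close> implements the convention \<open>c\<^sub>n\<^sub>+\<^sub>1 := 0\<close>.\<close>

definition zero_ext :: "nat \<Rightarrow> (nat \<Rightarrow> real) \<Rightarrow> nat \<Rightarrow> real" where
  "zero_ext n c k = (if k \<le> n then c k else 0)"

definition Delta :: "nat \<Rightarrow> (nat \<Rightarrow> real) \<Rightarrow> nat \<Rightarrow> real" where
  "Delta n c k = zero_ext n c k - zero_ext n c (k + 1)"

definition concave_seq :: "nat \<Rightarrow> (nat \<Rightarrow> real) \<Rightarrow> bool" where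
  "concave_seq n c \<longleftrightarrow>
     (\<forall>k\<le>n. zero_ext n c (k + 1) \<le> zero_ext n c k) \<and>
     (\<forall>k<n. Delta n c k \<le> Delta n c (k + 1))"

definition trig_poly :: "nat \<Rightarrow> (nat \<Rightarrow> real) \<Rightarrow> real \<Rightarrow> real" where
  "trig_poly n c x = c 0 + (\<Sum>k=1..n. 2 * c k * cos (real k * x))"

definition concave_trig_polys :: "nat \<Rightarrow> (real \<Rightarrow> real) set" where
  "concave_trig_polys n = {trig_poly n c | c. concave_seq n c}"

definition L1_norm :: "(real \<Rightarrow> real) \<Rightarrow> real" where
  "L1_norm f = integral {-pi..pi} (\<lambda>x. \<bar>f x\<bar>)"

text \<open>Suprema are taken in the extended reals, so that an unbounded set has supremum \<open>\<infinity>\<close>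
  and the empty set has supremum \<open>-\<infinity>\<close>.\<close>

definition sup_norm :: "(real \<Rightarrow> real) \<Rightarrow> ereal" where
  "sup_norm f = (SUP x\<in>{-pi..pi}. ereal \<bar>f x\<bar>)"

end

theory Submission
  imports Defs
begin

text \<open>
  Write \<open>N = n + 1\<close>, \<open>T = c\<^sub>0 + \<Sum> 2 c\<^sub>k cos kx\<close> and \<open>\<beta> = n^s + n^(s+1) / (s+1)\<close>, which is the size of
  \<open>\<Sum>\<^sub>k\<^sub>\<le>\<^sub>n k^s\<close>. Since the \<open>c\<^sub>k\<close> are nonnegative, the sup norm of the \<open>s\<close>-th derivative is
  at most \<open>2 \<Sum> c\<^sub>k k^s\<close>, and evaluation at \<open>0\<close> or at \<open>\<pi>/(2n)\<close> shows that it is at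
  least \<open>2 \<Sum> c\<^sub>k k^s (k/n)\<close> (\<open>sup_norm_iterated_deriv_ge\<close>). The issue is how small the \<open>L\<^sup>1\<close> norm can be for a given
  \<open>\<Sum> c\<^sub>k k^s\<close>.

  The \<open>L\<^sup>1\<close> norm is bounded below by Hardy's inequality for the shifted polynomial
  \<open>e^(iNx) T(x)\<close>, all of whose frequencies are positive:
  \<open>2 \<Sum> c\<^sub>k / (N - k) \<le> \<parallel>T\<parallel>\<^sub>1\<close> (\<open>hardy_inequality_trig_poly\<close>).

  Upper estimate. The weight \<open>k^s\<close> lives within distance about \<open>N/(s+1)\<close> of the end point
  \<open>N\<close>. Let \<open>P\<close> be this distance, rounded up, and compare everything with the single coefficient
  \<open>c\<^sub>p\<close>, \<open>p = N - P\<close>. Concavity says that \<open>c\<^sub>k\<close> decreases while \<open>c\<^sub>k / (N - k)\<close>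
  increases, so the sequence is bounded above and below, on both sides of \<open>p\<close>, by explicit multiples of \<open>c\<^sub>p\<close>. This gives
  \<open>\<Sum> c\<^sub>k k^s \<le> 4 \<beta> c\<^sub>p\<close> (\<open>sum_concave_coeff_powers_le\<close>) and
  \<open>\<Sum> c\<^sub>k / (N - k) \<ge> c\<^sub>p (1 + ln ((N+1)/(P+1)))\<close> (\<open>concave_coeff_harmonic_sum_ge\<close>).
  As \<open>N/P\<close> is about \<open>min (s+1) N\<close>, the last factor is at least a multiple of the smaller of
  \<open>ln (s+2)\<close> and \<open>ln (n+2)\<close>, which is what the theorem claims.

  Lower estimate. The extremal shape is the truncated tent \<open>c\<^sub>k = min Q (N - k)\<close> with \<open>Q\<close>
  about \<open>N/(2(s+2))\<close>, but at least \<open>1\<close>. Its polynomial is the sum of the \<open>Q\<close> Dirichlet kernels of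
  highest degree, for which one sees directly
  \<open>\<parallel>T\<parallel>\<^sub>1 \<le> 36 Q (1 + ln (N/Q))\<close> (\<open>L1_norm_tent_le\<close>), whereas \<open>\<Sum> c\<^sub>k k^s (k/n)\<close> is at least a
  multiple of \<open>Q \<beta>\<close> (\<open>sum_tent_coeff_powers_ge\<close>).
\<close>

section \<open>Power sums\<close>

text \<open>The mean value bounds for \<open>x ^ (s + 1)\<close> on a unit interval; summed over consecutive
  integers they compare power sums with \<open>n ^ (s + 1) / (s + 1)\<close>.\<close>
lemma power_increment_bounds:
  fixes x :: real
  assumes "x \<ge> 0"
  shows "real (s + 1) * x ^ s \<le> (x + 1) ^ (s + 1) - x ^ (s + 1)"
    and "(x + 1) ^ (s + 1) - x ^ (s + 1) \<le> real (s + 1) * (x + 1) ^ s"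
proof (induction s)
  case (Suc s)
  {
    case 1
    have "real (Suc s + 1) * x ^ Suc s \<le> (x + 1) * (real (s + 1) * x ^ s) + x ^ (s + 1)"
      using assms by (simp add: algebra_simps)
    also have "\<dots> \<le> (x + 1) * ((x + 1) ^ (s + 1) - x ^ (s + 1)) + x ^ (s + 1)"
      using assms Suc(1) by (intro add_right_mono mult_left_mono) auto
    finally show ?case by (simp add: algebra_simps)
  next
    case 2
    have "(x + 1) ^ (Suc s + 1) - x ^ (Suc s + 1)
        = x * ((x + 1) ^ (s + 1) - x ^ (s + 1)) + (x + 1) ^ (s + 1)"
      by (simp add: algebra_simps)
    also have "\<dots> \<le> x * (real (s + 1) * (x + 1) ^ s) + (x + 1) ^ (s + 1)"
      using assms Suc(2) by (intro add_right_mono mult_left_mono) auto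
    also have "\<dots> \<le> real (Suc s + 1) * (x + 1) ^ Suc s"
      using assms by (simp add: algebra_simps)
    finally show ?case .
  }
qed auto

lemma sum_powers_le:
  "(\<Sum>k\<le>n. real k ^ s) \<le> real n ^ s + real n ^ (s + 1) / real (s + 1)"
proof (induction n)
  case (Suc n)
  have "real n ^ s + real n ^ (s + 1) / real (s + 1) \<le> real (Suc n) ^ (s + 1) / real (s + 1)"
    using power_increment_bounds(1)[of "real n" s]
    by (simp add: divide_simps) (simp add: algebra_simps)
  with Suc show ?case by simp
qed (cases s; simp)

lemma sum_powers_ge:
  "real n ^ (s + 1) / real (s + 1) \<le> (\<Sum>k\<le>n. real k ^ s)"
proof (induction n)
  case (Suc n)
  have "real (Suc n) ^ (s + 1) / real (s + 1) \<le> real n ^ (s + 1) / real (s + 1) + real (Suc n) ^ s"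
    using power_increment_bounds(2)[of "real n" s]
    by (simp add: divide_simps) (simp add: algebra_simps)
  with Suc show ?case by simp
qed auto

text \<open>The weight \<open>n + 1 - k\<close> counts the indices \<open>l\<close> with \<open>k \<le> l \<le> n\<close>, so the left-hand side is a sum
  of power sums, and the bound for power sums applies twice.\<close>
lemma sum_linear_weight_powers_le:
  "(\<Sum>k\<le>n. (real n + 1 - real k) * real k ^ s)
     \<le> real n ^ s + 2 * real n ^ (s + 1) / real (s + 1)
        + real n ^ (s + 2) / (real (s + 1) * real (s + 2))"
proof -
  have "(\<Sum>k\<le>n. (real n + 1 - real k) * real k ^ s) = (\<Sum>l\<le>n. \<Sum>k\<le>l. real k ^ s)"
  proof (induction n)
    case (Suc n)
    have "(\<Sum>k\<le>n. (real (Suc n) + 1 - real k) * real k ^ s)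
        = (\<Sum>k\<le>n. (real n + 1 - real k) * real k ^ s) + (\<Sum>k\<le>n. real k ^ s)"
      by (simp add: sum.distrib[symmetric] algebra_simps)
    with Suc show ?case by simp
  qed simp
  also have "\<dots> \<le> (\<Sum>l\<le>n. real l ^ s + real l ^ (s + 1) / real (s + 1))"
    by (intro sum_mono sum_powers_le)
  also have "\<dots> = (\<Sum>l\<le>n. real l ^ s) + (\<Sum>l\<le>n. real l ^ (s + 1)) / real (s + 1)"
    by (simp add: sum.distrib sum_divide_distrib)
  also have "\<dots> \<le> (real n ^ s + real n ^ (s + 1) / real (s + 1))
      + (real n ^ (s + 1) + real n ^ (s + 2) / real (s + 2)) / real (s + 1)"
    using sum_powers_le[of s n] sum_powers_le[of "s+1" n]
    by (intro add_mono divide_right_mono) auto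
  also have "\<dots> = real n ^ s + 2 * real n ^ (s + 1) / real (s + 1)
        + real n ^ (s + 2) / (real (s + 1) * real (s + 2))"
    by (simp add: add_divide_distrib mult.commute)
  finally show ?thesis .
qed


section \<open>Coefficients of concave sequences\<close>

lemma
  assumes "concave_seq n c"
  shows concave_seq_decreasing: "k \<le> l \<Longrightarrow> l \<le> n \<Longrightarrow> c l \<le> c k"
    and concave_seq_nonneg: "k \<le> n \<Longrightarrow> 0 \<le> c k"
proof -
  have step: "zero_ext n c (Suc k) \<le> zero_ext n c k" for k
    using assms by (cases "k \<le> n") (auto simp: concave_seq_def zero_ext_def)
  have anti: "zero_ext n c l \<le> zero_ext n c k" if "k \<le> l" for k l
    using lift_Suc_antimono_le[of "zero_ext n c", OF step that] .
  show "k \<le> l \<Longrightarrow> l \<le> n \<Longrightarrow> c l \<le> c k"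
    using anti[of k l] by (simp add: zero_ext_def)
  show "k \<le> n \<Longrightarrow> 0 \<le> c k"
    using anti[of k "Suc n"] by (simp add: zero_ext_def)
qed

text \<open>The ratio is the slope of the chord from \<open>(k, c\<^sub>k)\<close> to \<open>(n + 1, 0)\<close>, up to sign: it is the
  average of the differences \<open>\<Delta>c\<^sub>j\<close>, \<open>k \<le> j \<le> n\<close>. These increase with \<open>j\<close>, so that dropping the first
  ones increases the average.\<close>
lemma concave_seq_ratio_mono:
  assumes "concave_seq n c" "k \<le> l" "l \<le> n"
  shows "c k / (real n + 1 - real k) \<le> c l / (real n + 1 - real l)"
proof -
  let ?z = "zero_ext n c"
  \<comment> \<open>The first of the differences is at most their average.\<close>
  have bound: "(real n + 1 - real k) * Delta n c k \<le> ?z k" if "k \<le> n" for k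
    using that
  proof (induction rule: inc_induct)
    case base
    then show ?case by (simp add: Delta_def zero_ext_def)
  next
    case (step j)
    have "(real n - real j) * Delta n c j \<le> (real n - real j) * Delta n c (j + 1)"
      using assms(1) step by (intro mult_left_mono) (auto simp: concave_seq_def)
    moreover have "?z j = Delta n c j + ?z (Suc j)" by (simp add: Delta_def)
    ultimately show ?case using step by (simp add: algebra_simps)
  qed
  show ?thesis
    using assms(2,3)
  proof (induction rule: dec_induct)
    case (step j)
    have pos: "real n - real j > 0" using step by simp
    have "c j * (real n - real j) \<le> c (Suc j) * (real n + 1 - real j)"
      using bound[of j] step by (simp add: Delta_def zero_ext_def algebra_simps)
    then have "c j / (real n + 1 - real j) \<le> c (Suc j) / (real n + 1 - real (Suc j))"
      using pos by (simp add: divide_simps) 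
    with step show ?case by simp
  qed simp
qed

section \<open>Derivatives of trigonometric polynomials\<close>

definition cos_weight :: "nat \<Rightarrow> real" where
  "cos_weight k = (if k = 0 then 1 else 2)"

lemma cos_weight_bounds: "1 \<le> cos_weight k" "cos_weight k \<le> 2"
  by (auto simp: cos_weight_def)

lemma trig_poly_eq_sum: "trig_poly n c x = (\<Sum>k\<le>n. cos_weight k * c k * cos (real k * x))"
proof -
  have "{..n} = insert 0 {1..n}" by auto
  then show ?thesis by (simp add: trig_poly_def cos_weight_def)
qed

text \<open>Each derivative multiplies the \<open>k\<close>-th term by \<open>k\<close> and shifts its phase by \<open>\<pi>/2\<close>. The convention \<open>0 ^ 0 = 1\<close> makes the constant term right for \<open>s = 0\<close>.\<close>
lemma iterated_deriv_trig_poly: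
  "(deriv ^^ s) (trig_poly n c)
     = (\<lambda>x. \<Sum>k\<le>n. cos_weight k * c k * real k ^ s * cos (real k * x + real s * (pi / 2)))"
proof (induction s)
  case 0
  show ?case by (simp add: trig_poly_eq_sum fun_eq_iff)
next
  case (Suc s)
  have shift: "cos (t + real (Suc s) * (pi / 2)) = - sin (t + real s * (pi / 2))" for t
    using cos_add[of "t + real s * (pi / 2)" "pi / 2"]
    by (simp add: algebra_simps add_divide_distrib)
  have "((\<lambda>x. \<Sum>k\<le>n. cos_weight k * c k * real k ^ s * cos (real k * x + real s * (pi / 2)))
          has_field_derivative
        (\<Sum>k\<le>n. cos_weight k * c k * real k ^ Suc s * cos (real k * x + real (Suc s) * (pi / 2))))
        (at x)" for x
    unfolding shift
    by (auto intro!: derivative_eq_intros sum.cong simp: algebra_simps)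
  with Suc show ?case
    by (auto intro!: ext DERIV_imp_deriv)
qed

lemma continuous_on_trig_poly [continuous_intros]: "continuous_on A (trig_poly n c)"
  unfolding trig_poly_def by (intro continuous_intros)

lemma trig_poly_even: "trig_poly n c (- x) = trig_poly n c x"
  by (simp add: trig_poly_def)


section \<open>Hardy's inequality\<close>

lemma L1_norm_even:
  assumes "\<And>x. f (- x) = f x" "continuous_on {- pi..pi} f"
  shows "L1_norm f = 2 * integral {0..pi} (\<lambda>x. \<bar>f x\<bar>)"
proof -
  let ?g = "\<lambda>x. \<bar>f x\<bar>"
  have int: "?g integrable_on {- pi..pi}"
    using assms(2) by (intro integrable_continuous_interval continuous_intros)
  have "integral {- pi..pi} ?g = integral {- pi..0} ?g + integral {0..pi} ?g"
    using Henstock_Kurzweil_Integration.integral_combine[OF _ _ int, of 0] by simp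
  moreover have "integral {- pi..0} ?g = integral {0..pi} ?g"
    using Henstock_Kurzweil_Integration.integral_reflect_real[of pi 0 ?g] assms(1) by simp
  ultimately show ?thesis by (simp add: L1_norm_def)
qed

text \<open>The sine coefficients of the sawtooth \<open>\<pi> - x\<close>: a bounded function with coefficients \<open>1/a\<close>, which is
  the dual function behind Hardy's inequality.\<close>
lemma has_integral_sawtooth_sin:
  assumes "a > 0" "sin (a * pi) = 0"
  shows "((\<lambda>x. (pi - x) * sin (a * x)) has_integral pi / a) {0..pi}"
proof -
  let ?F = "\<lambda>x. - ((pi - x) * cos (a * x) / a) - sin (a * x) / a\<^sup>2"
  have "((\<lambda>x. (pi - x) * sin (a * x)) has_integral ?F pi - ?F 0) {0..pi}"
    using assms(1)
    by (intro fundamental_theorem_of_calculus)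
       (auto intro!: derivative_eq_intros simp: has_real_derivative_iff_has_vector_derivative[symmetric]
          field_simps power2_eq_square)
  with assms show ?thesis by simp
qed

text \<open>Integrate \<open>T(x) sin (Nx)\<close>, \<open>N = n + 1\<close>, against the sawtooth \<open>\<pi> - x\<close> over \<open>[0, \<pi>]\<close>. The product with
  \<open>sin (Nx)\<close> moves the frequency \<open>k\<close> to \<open>N \<plusminus> k\<close>, both positive, so the integral is a sum of
  nonnegative terms containing \<open>\<pi> c\<^sub>k / (N - k)\<close>, while the sawtooth is bounded by \<open>\<pi>\<close>.\<close>
lemma hardy_inequality_trig_poly:
  assumes "\<And>k. k \<le> n \<Longrightarrow> 0 \<le> c k"
  shows "2 * (\<Sum>k\<le>n. c k / (real n + 1 - real k)) \<le> L1_norm (trig_poly n c)"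
proof -
  let ?N = "real (Suc n)" and ?T = "trig_poly n c"
  let ?g = "\<lambda>x. ?T x * ((pi - x) * sin (?N * x))"
  have int_T: "(\<lambda>x. \<bar>?T x\<bar>) integrable_on {0..pi}"
    by (intro integrable_continuous_interval continuous_intros)
  have g_eq: "?g x = (\<Sum>k\<le>n. cos_weight k * c k / 2 *
      ((pi - x) * sin (real (Suc n + k) * x) + (pi - x) * sin (real (Suc n - k) * x)))" for x
    unfolding trig_poly_eq_sum sum_distrib_right
  proof (rule sum.cong)
    fix k assume "k \<in> {..n}"
    then have "real (Suc n - k) * x = ?N * x - real k * x" "real (Suc n + k) * x = ?N * x + real k * x"
      by (simp_all add: algebra_simps of_nat_diff)
    then show "cos_weight k * c k * cos (real k * x) * ((pi - x) * sin (?N * x)) =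
        cos_weight k * c k / 2 *
        ((pi - x) * sin (real (Suc n + k) * x) + (pi - x) * sin (real (Suc n - k) * x))"
      by (simp only: sin_add sin_diff) (simp add: algebra_simps)
  qed simp
  have "(?g has_integral (\<Sum>k\<le>n. cos_weight k * c k / 2 *
      (pi / real (Suc n + k) + pi / real (Suc n - k)))) {0..pi}"
    unfolding g_eq
    by (intro has_integral_sum has_integral_mult_right has_integral_add has_integral_sawtooth_sin)
       (auto simp del: of_nat_add of_nat_Suc of_nat_diff)
  then have int_g: "?g integrable_on {0..pi}"
    and "integral {0..pi} ?g = (\<Sum>k\<le>n. cos_weight k * c k / 2 *
      (pi / real (Suc n + k) + pi / real (Suc n - k)))"
    by (auto simp: has_integral_iff)
  note int_g this(2)
  moreover have "(\<Sum>k\<le>n. pi * (c k / (real n + 1 - real k)))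
      \<le> (\<Sum>k\<le>n. cos_weight k * c k / 2 * (pi / real (Suc n + k) + pi / real (Suc n - k)))"
  proof (rule sum_mono)
    fix k assume k: "k \<in> {..n}"
    show "pi * (c k / (real n + 1 - real k))
      \<le> cos_weight k * c k / 2 * (pi / real (Suc n + k) + pi / real (Suc n - k))"
    proof (cases "k = 0")
      case False
      have "pi * (c k / (real n + 1 - real k)) = c k * (pi / real (Suc n - k))"
        using k by (simp add: of_nat_diff add.commute)
      also have "\<dots> \<le> c k * (pi / real (Suc n + k) + pi / real (Suc n - k))"
        using k assms by (intro mult_left_mono) auto
      finally show ?thesis using False by (simp add: cos_weight_def)
    qed (simp add: cos_weight_def algebra_simps)
  qed
  moreover have "integral {0..pi} ?g \<le> integral {0..pi} (\<lambda>x. pi * \<bar>?T x\<bar>)"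
  proof (rule integral_le[OF int_g])
    show "(\<lambda>x. pi * \<bar>?T x\<bar>) integrable_on {0..pi}"
      using integrable_on_cmult_left[OF int_T, of pi] by simp
    fix x :: real assume x: "x \<in> {0..pi}"
    have "?g x \<le> \<bar>?T x\<bar> * (\<bar>pi - x\<bar> * \<bar>sin (?N * x)\<bar>)"
      by (metis abs_ge_self abs_mult)
    also have "\<dots> \<le> \<bar>?T x\<bar> * (pi * 1)"
      using x by (intro mult_left_mono mult_mono) auto
    finally show "?g x \<le> pi * \<bar>?T x\<bar>" by (simp add: mult.commute)
  qed
  ultimately have "pi * (\<Sum>k\<le>n. c k / (real n + 1 - real k)) \<le> pi * integral {0..pi} (\<lambda>x. \<bar>?T x\<bar>)"
    by (simp add: sum_distrib_left)
  then show ?thesis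
    using L1_norm_even[of ?T] trig_poly_even continuous_on_trig_poly by simp
qed

section \<open>The upper estimate\<close>

text \<open>To the right of \<open>p\<close> use that \<open>c\<close> decreases, to the left that \<open>c\<^sub>k / (n + 1 - k)\<close> increases; the
  factor is the sum of the two resulting bounds.\<close>
lemma concave_seq_le_anchor:
  assumes "concave_seq n c" "k \<le> n" "p \<le> n"
  shows "c k \<le> c p * (1 + (real n + 1 - real k) / (real n + 1 - real p))"
proof -
  have nonneg: "0 \<le> c p * ((real n + 1 - real k) / (real n + 1 - real p))"
    using assms concave_seq_nonneg[OF assms(1)] by (intro mult_nonneg_nonneg divide_nonneg_nonneg) auto
  consider "p \<le> k" | "k \<le> p" by linarith
  then show ?thesis
  proof cases
    case 1
    then show ?thesis
      using concave_seq_decreasing[OF assms(1) 1 assms(2)] nonneg by (simp add: distrib_left)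
  next
    case 2
    then have "c k \<le> c p / (real n + 1 - real p) * (real n + 1 - real k)"
      using concave_seq_ratio_mono[OF assms(1) 2 assms(3)] assms(2) by (simp add: pos_divide_le_eq)
    then show ?thesis
      using concave_seq_nonneg[OF assms(1,3)] by (simp add: distrib_left)
  qed
qed

text \<open>By the comparison with \<open>c\<^sub>p\<close>, \<open>p = n + 1 - P\<close>, the sum splits into a power sum and a linearly
  weighted power sum divided by \<open>P\<close>. The weighted one is of order \<open>n ^ (s + 2) / (s + 1) ^ 2\<close> when \<open>s\<close> is
  small compared with \<open>n\<close>, and division by \<open>P \<ge> (n + 1) / (s + 1)\<close> brings it down to the
  size of the power sum.\<close>
lemma sum_concave_coeff_powers_le:
  assumes c: "concave_seq n c" and "1 \<le> P" "P \<le> n + 1" and P: "n + 1 \<le> (s + 1) * P"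
  shows "(\<Sum>k\<le>n. c k * real k ^ s)
           \<le> 4 * c (n + 1 - P) * (real n ^ s + real n ^ (s + 1) / real (s + 1))"
proof -
  let ?p = "n + 1 - P" and ?S1 = "\<Sum>k\<le>n. real k ^ s"
    and ?S2 = "\<Sum>k\<le>n. (real n + 1 - real k) * real k ^ s"
    and ?B = "real n ^ s + real n ^ (s + 1) / real (s + 1)"
  have p: "?p \<le> n" and Pp: "real n + 1 - real ?p = real P" using assms by (auto simp: of_nat_diff)
  have cp: "0 \<le> c ?p" using concave_seq_nonneg[OF c p] .
  have "(\<Sum>k\<le>n. c k * real k ^ s)
      \<le> (\<Sum>k\<le>n. c ?p * (1 + (real n + 1 - real k) / real P) * real k ^ s)"
    using concave_seq_le_anchor[OF c _ p, unfolded Pp] by (intro sum_mono mult_right_mono) auto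
  also have "\<dots> = c ?p * (?S1 + ?S2 / real P)"
    by (simp add: sum_distrib_left sum_divide_distrib sum.distrib[symmetric] algebra_simps
        flip: add_divide_distrib)
  also have "\<dots> \<le> c ?p * (?B + 3 * ?B)"
  proof (intro mult_left_mono add_mono sum_powers_le cp)
    have "real n \<le> (real s + 2) * real P"
    proof -
      have "n \<le> (s + 2) * P" using P by simp
      then have "real n \<le> real ((s + 2) * P)" by (rule of_nat_mono)
      then show ?thesis by (simp add: algebra_simps)
    qed
    then have ratio: "real n / (real P * (real s + 2)) \<le> 1"
      using assms(2) by (simp add: divide_simps mult.commute)
    have "?S2 / real P \<le> (real n ^ s + 2 * real n ^ (s + 1) / real (s + 1)) / real P
        + real n ^ (s + 1) / real (s + 1) * (real n / (real P * (real s + 2)))"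
      using divide_right_mono[OF sum_linear_weight_powers_le[of n s], of "real P"]
      by (simp add: add_divide_distrib algebra_simps)
    also have "\<dots> \<le> (real n ^ s + 2 * real n ^ (s + 1) / real (s + 1)) / 1
        + real n ^ (s + 1) / real (s + 1) * 1"
      using assms(2) ratio by (intro add_mono divide_left_mono mult_left_mono) auto
    also have "\<dots> \<le> 3 * ?B" by simp
    finally show "?S2 / real P \<le> 3 * ?B" .
  qed
  finally show ?thesis by (simp only: mult_ac) (simp add: algebra_simps)
qed

text \<open>The terms \<open>j \<le> P\<close> contribute exactly \<open>1\<close> and the others a harmonic tail.\<close>
lemma one_plus_ln_le_truncated_harmonic:
  assumes "1 \<le> P" "P \<le> N"
  shows "1 + ln (real (N + 1) / real (P + 1)) \<le> (\<Sum>j=1..N. if j \<le> P then 1 / real P else 1 / real j)"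
  using assms(2)
proof (induction rule: dec_induct)
  case base
  show ?case using assms by simp
next
  case (step N)
  have "ln (real (Suc N + 1) / real (P + 1))
      = ln (real (N + 1) / real (P + 1)) + ln (1 + 1 / real (N + 1))"
  proof (subst ln_mult_pos[symmetric])
    have "real (Suc N + 1) = real (N + 1) * (1 + 1 / real (N + 1))"
      by (simp add: field_simps)
    then show "ln (real (Suc N + 1) / real (P + 1))
        = ln (real (N + 1) / real (P + 1) * (1 + 1 / real (N + 1)))"
      by simp
  qed (auto simp: add_pos_nonneg)
  also have "ln (1 + 1 / real (N + 1)) \<le> 1 / real (N + 1)"
    by (rule ln_add_one_self_le_self) simp
  finally show ?case using step by simp
qed

text \<open>The two monotonicities in the opposite roles: to the right of \<open>p = n + 1 - P\<close> the
  ratio is at least \<open>c\<^sub>p / P\<close>, to the left \<open>c\<^sub>k \<ge> c\<^sub>p\<close>. In terms of \<open>j = n + 1 - k\<close> this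
  leaves the truncated harmonic sum.\<close>
lemma concave_coeff_harmonic_sum_ge:
  assumes c: "concave_seq n c" and "1 \<le> P" "P \<le> n + 1"
  shows "c (n + 1 - P) * (1 + ln ((real n + 2) / (real P + 1)))
           \<le> (\<Sum>k\<le>n. c k / (real n + 1 - real k))"
proof -
  let ?p = "n + 1 - P"
  have p: "?p \<le> n" and Pp: "real n + 1 - real ?p = real P" using assms by (auto simp: of_nat_diff)
  have cp: "0 \<le> c ?p" using concave_seq_nonneg[OF c p] .
  have "c ?p * (1 + ln (real (n + 1 + 1) / real (P + 1)))
      \<le> c ?p * (\<Sum>j=1..n+1. if j \<le> P then 1 / real P else 1 / real j)"
    by (intro mult_left_mono one_plus_ln_le_truncated_harmonic assms cp)
  also have "\<dots> = (\<Sum>j=1..n+1. c ?p * (if j \<le> P then 1 / real P else 1 / real j))"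
    by (rule sum_distrib_left)
  also have "\<dots> = (\<Sum>k\<le>n. c ?p * (if n + 1 - k \<le> P then 1 / real P else 1 / real (n + 1 - k)))"
    by (rule sum.reindex_bij_witness[of _ "\<lambda>k. n + 1 - k" "\<lambda>j. n + 1 - j"]) auto
  also have "\<dots> \<le> (\<Sum>k\<le>n. c k / (real n + 1 - real k))"
  proof (rule sum_mono)
    fix k assume k: "k \<in> {..n}"
    then have Nk: "real (n + 1 - k) = real n + 1 - real k" by (simp add: of_nat_diff)
    show "c ?p * (if n + 1 - k \<le> P then 1 / real P else 1 / real (n + 1 - k))
        \<le> c k / (real n + 1 - real k)"
    proof (cases "n + 1 - k \<le> P")
      case True
      then have "?p \<le> k" by linarith
      then show ?thesis
        using True concave_seq_ratio_mono[OF c, of ?p k] k Pp by simp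
    next
      case False
      then have "k \<le> ?p" by linarith
      then show ?thesis
        using False concave_seq_decreasing[OF c, of k ?p] k p Nk
        by (simp add: divide_right_mono add.commute)
    qed
  qed
  finally show ?thesis by (simp add: add.commute)
qed

text \<open>The condition on \<open>P\<close> says that \<open>P\<close> does not exceed \<open>1 + (n + 1) / (s + 1)\<close>, so \<open>(n + 2) / (P + 1)\<close> is at
  least a third of \<open>1 + min n s\<close>. Hence \<open>1 + ln ((n + 2) / (P + 1))\<close> beats half of the smaller one of the two
  logarithms, and the larger of the two reciprocals alone gives the claim.\<close>
lemma harmonic_factor_cancels_log_factor:
  assumes "1 \<le> P" "P \<le> n + 1" "(s + 1) * (P - 1) \<le> n + 1"
  shows "1 \<le> 2 * (1 + ln ((real n + 2) / (real P + 1))) * (1 / ln (real s + 2) + 1 / ln (real n + 2))"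
proof -
  define h where "h = ln ((real n + 2) / (real P + 1))"
  define q where "q = min n s"
  have lnpos: "0 < ln (real s + 2)" "0 < ln (real n + 2)" by simp_all
  have lnq: "0 < ln (real q + 2)" by simp
  have h: "0 \<le> h" using assms by (simp add: h_def)
  have "(real q + 1) / 3 \<le> (real n + 2) / (real P + 1)"
  proof -
    have a: "(real s + 1) * (real P - 1) \<le> real n + 1"
      using of_nat_mono[OF assms(3), where 'a=real] assms(1)
      by (simp only: of_nat_mult of_nat_diff of_nat_add of_nat_1)
    have q1: "real q + 1 \<le> real n + 1" "real q + 1 \<le> real s + 1" by (auto simp: q_def)
    have "(real q + 1) * (real P - 1) \<le> (real s + 1) * (real P - 1)"
      using q1 assms(1) by (intro mult_right_mono) auto
    then have "(real q + 1) * (real P + 1) \<le> 3 * (real n + 2)"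
      using a q1 by (simp add: algebra_simps)
    then show ?thesis by (simp add: divide_simps algebra_simps)
  qed
  then have "ln ((real q + 1) / 3) \<le> h"
    unfolding h_def by (subst ln_le_cancel_iff) auto
  \<comment> \<open>The constant 6 comes from \<open>q + 2 \<le> 2 * (q + 1)\<close> and the factor 3 above.\<close>
  moreover have "ln (real q + 2) \<le> ln 6 + ln ((real q + 1) / 3)"
  proof -
    have "ln (real q + 2) \<le> ln (6 * ((real q + 1) / 3))"
      by (subst ln_le_cancel_iff) auto
    also have "\<dots> = ln 6 + ln ((real q + 1) / 3)" by (rule ln_mult_pos) auto
    finally show ?thesis .
  qed
  moreover have "ln 6 \<le> (2::real)"
  proof -
    have "6 \<le> (1 + 2 / real 10) ^ 10" by (simp add: power_divide)
    also have "\<dots> \<le> exp 2" by (rule exp_ge_one_plus_x_over_n_power_n) auto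
    finally show ?thesis using ln_le_cancel_iff[of 6 "exp 2"] by simp
  qed
  ultimately have "ln (real q + 2) \<le> 2 + h" by (meson add_mono order_trans)
  then have "ln (real q + 2) \<le> 2 * (1 + h)" using h by simp
  then have "1 \<le> 2 * (1 + h) * (1 / ln (real q + 2))" using lnq by (simp add: divide_simps)
  also have "\<dots> \<le> 2 * (1 + h) * (1 / ln (real s + 2) + 1 / ln (real n + 2))"
    using h lnpos by (intro mult_left_mono) (auto simp: q_def min_def)
  finally show ?thesis by (simp only: h_def)
qed

lemma concave_coeff_sum_le_L1_norm:
  assumes c: "concave_seq n c"
  shows "(\<Sum>k\<le>n. c k * real k ^ s)
      \<le> 4 * (real n ^ s + real n ^ (s + 1) / real (s + 1))
            * (1 / ln (real s + 2) + 1 / ln (real n + 2)) * L1_norm (trig_poly n c)"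
proof -
  \<comment> \<open>This is \<open>(n + 1) / (s + 1)\<close> rounded up.\<close>
  define P where "P = Suc (n div (s + 1))"
  have P: "1 \<le> P" "P \<le> n + 1" "n + 1 \<le> (s + 1) * P" "(s + 1) * (P - 1) \<le> n + 1"
    using dividend_less_times_div[of "s + 1" n] times_div_less_eq_dividend[of "s + 1" n]
    by (simp_all add: P_def)
  let ?p = "n + 1 - P" and ?B = "real n ^ s + real n ^ (s + 1) / real (s + 1)"
    and ?H = "1 + ln ((real n + 2) / (real P + 1))"
    and ?L = "1 / ln (real s + 2) + 1 / ln (real n + 2)"
  have L: "0 \<le> ?L" by simp
  have cp: "0 \<le> c ?p" using concave_seq_nonneg[OF c] P by simp
  have "2 * (c ?p * ?H) \<le> L1_norm (trig_poly n c)"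
    using concave_coeff_harmonic_sum_ge[OF c P(1,2)]
      hardy_inequality_trig_poly[of n c] concave_seq_nonneg[OF c] by fastforce
  then have HL: "2 * (c ?p * ?H) * ?L \<le> L1_norm (trig_poly n c) * ?L"
    by (intro mult_right_mono L)
  have "c ?p * 1 \<le> c ?p * (2 * ?H * ?L)"
    by (intro mult_left_mono harmonic_factor_cancels_log_factor P cp)
  also have "\<dots> = 2 * (c ?p * ?H) * ?L" by (simp only: mult_ac)
  also note HL
  finally have cpL: "c ?p \<le> L1_norm (trig_poly n c) * ?L" by simp
  have "(\<Sum>k\<le>n. c k * real k ^ s) \<le> 4 * ?B * c ?p"
    using sum_concave_coeff_powers_le[OF c P(1,2,3)] by (simp only: mult_ac)
  also have "\<dots> \<le> 4 * ?B * (L1_norm (trig_poly n c) * ?L)"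
    by (intro mult_left_mono cpL) auto
  finally show ?thesis by (simp only: mult_ac)
qed

lemma sup_norm_iterated_deriv_le:
  assumes c: "concave_seq n c"
  shows "sup_norm ((deriv ^^ s) (trig_poly n c))
     \<le> ereal (8 * (real n ^ s + real n ^ (s + 1) / real (s + 1))
            * (1 / ln (real s + 2) + 1 / ln (real n + 2)) * L1_norm (trig_poly n c))"
  unfolding sup_norm_def
proof (rule SUP_least)
  fix x :: real
  have "\<bar>(deriv ^^ s) (trig_poly n c) x\<bar>
      \<le> (\<Sum>k\<le>n. \<bar>cos_weight k * c k * real k ^ s * cos (real k * x + real s * (pi / 2))\<bar>)"
    unfolding iterated_deriv_trig_poly by (rule sum_abs)
  also have "\<dots> \<le> (\<Sum>k\<le>n. 2 * (c k * real k ^ s))"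
  proof (rule sum_mono)
    fix k assume "k \<in> {..n}"
    then have ck: "0 \<le> c k" using concave_seq_nonneg[OF c, of k] by simp
    then have "0 \<le> c k * real k ^ s" by simp
    then have "cos_weight k * (c k * real k ^ s) * \<bar>cos (real k * x + real s * (pi / 2))\<bar>
        \<le> 2 * (c k * real k ^ s) * 1"
      using cos_weight_bounds[of k] ck by (intro mult_mono) auto
    then show "\<bar>cos_weight k * c k * real k ^ s * cos (real k * x + real s * (pi / 2))\<bar>
        \<le> 2 * (c k * real k ^ s)"
      using ck cos_weight_bounds(1)[of k]
      by (simp add: abs_mult mult.assoc)
  qed
  also have "\<dots> \<le> 8 * (real n ^ s + real n ^ (s + 1) / real (s + 1))
            * (1 / ln (real s + 2) + 1 / ln (real n + 2)) * L1_norm (trig_poly n c)"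
    using mult_left_mono[OF concave_coeff_sum_le_L1_norm[OF c, of s], of 2]
    by (simp only: sum_distrib_left mult.assoc[symmetric]) simp
  finally show "ereal \<bar>(deriv ^^ s) (trig_poly n c) x\<bar>
      \<le> ereal (8 * (real n ^ s + real n ^ (s + 1) / real (s + 1))
            * (1 / ln (real s + 2) + 1 / ln (real n + 2)) * L1_norm (trig_poly n c))" by simp
qed

section \<open>Sums of the highest Dirichlet kernels\<close>

text \<open>Jordan's inequality: the concave function \<open>sin\<close> lies above its chord on \<open>[0, \<pi>/2]\<close>.\<close>
lemma jordan_inequality:
  assumes "0 \<le> t" "t \<le> pi / 2"
  shows "2 * t / pi \<le> sin t"
proof -
  have "concave_on {0..pi / 2} sin"
  proof (rule f''_le0_imp_concave)
    show "- sin x \<le> 0" if "x \<in> {0..pi / 2}" for x :: real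
      using that by (auto intro!: sin_ge_zero)
  qed (auto intro!: derivative_eq_intros)
  from concave_onD[OF this, of "2 * t / pi" 0 "pi / 2"] assms show ?thesis
    by (simp add: divide_simps)
qed

text \<open>The truncated subtraction makes the values beyond \<open>n\<close> vanish, as the zero extension does.\<close>
definition tent_coeff :: "nat \<Rightarrow> nat \<Rightarrow> nat \<Rightarrow> real" where
  "tent_coeff n Q k = real (min Q (n + 1 - k))"

lemma concave_seq_tent_coeff: "concave_seq n (tent_coeff n Q)"
proof -
  have z: "zero_ext n (tent_coeff n Q) k = real (min Q (n + 1 - k))" for k
    by (auto simp: zero_ext_def tent_coeff_def)
  show ?thesis
    unfolding concave_seq_def Delta_def z by (auto simp: min_def of_nat_diff)
qed

lemma concave_seq_divide:
  assumes "concave_seq n c" "0 < L"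
  shows "concave_seq n (\<lambda>k. c k / L)"
proof -
  have z: "zero_ext n (\<lambda>k. c k / L) k = zero_ext n c k / L" for k
    by (simp add: zero_ext_def)
  show ?thesis
    using assms unfolding concave_seq_def Delta_def z
    by (auto simp: divide_right_mono simp flip: diff_divide_distrib)
qed

text \<open>The tent is the sum of the indicator functions of \<open>{0..n}\<close>, \<open>{0..n-1}\<close>, ..., \<open>{0..n-Q+1}\<close>.\<close>
lemma sum_tent_coeff:
  assumes "Q \<le> n + 1"
  shows "(\<Sum>k\<le>n. tent_coeff n Q k * f k) = (\<Sum>i<Q. \<Sum>k\<le>n - i. f k)"
  using assms
proof (induction Q)
  case (Suc Q)
  have "(\<Sum>k\<le>n. tent_coeff n (Suc Q) k * f k)
      = (\<Sum>k\<le>n. tent_coeff n Q k * f k + (if k \<le> n - Q then f k else 0))"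
    using Suc.prems by (intro sum.cong) (auto simp: tent_coeff_def min_def algebra_simps)
  also have "\<dots> = (\<Sum>k\<le>n. tent_coeff n Q k * f k) + (\<Sum>k\<le>n - Q. f k)"
    by (simp add: sum.distrib sum.inter_filter[symmetric]) (intro sum.cong; auto)
  finally show ?case using Suc by simp
qed (simp add: tent_coeff_def)

definition dirichlet_kernel :: "nat \<Rightarrow> real \<Rightarrow> real" where
  "dirichlet_kernel l x = (\<Sum>k\<le>l. cos_weight k * cos (real k * x))"

lemma dirichlet_kernel_closed_form:
  "dirichlet_kernel l x * sin (x / 2) = sin ((real l + 1 / 2) * x)"
proof (induction l)
  case (Suc l)
  have "sin ((real (Suc l) + 1 / 2) * x) - sin ((real l + 1 / 2) * x)
      = 2 * (sin (x / 2) * cos (real (Suc l) * x))"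
    using sin_add[of "real (Suc l) * x" "x / 2"] sin_diff[of "real (Suc l) * x" "x / 2"]
    by (simp add: algebra_simps)
  with Suc show ?case by (simp add: dirichlet_kernel_def cos_weight_def algebra_simps)
qed (simp add: dirichlet_kernel_def cos_weight_def)

lemma abs_dirichlet_kernel_le: "\<bar>dirichlet_kernel l x\<bar> \<le> 2 * (real l + 1)"
proof -
  have "\<bar>dirichlet_kernel l x\<bar> \<le> (\<Sum>k\<le>l. \<bar>cos_weight k * cos (real k * x)\<bar>)"
    unfolding dirichlet_kernel_def by (rule sum_abs)
  also have "\<dots> \<le> (\<Sum>k\<le>l. 2 * 1)"
    using cos_weight_bounds
    by (intro sum_mono) (auto simp: abs_mult cos_weight_def intro!: mult_mono)
  finally show ?thesis by (simp add: algebra_simps)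
qed

lemma trig_poly_tent_coeff:
  assumes "Q \<le> n + 1"
  shows "trig_poly n (tent_coeff n Q) x = (\<Sum>i<Q. dirichlet_kernel (n - i) x)"
  using sum_tent_coeff[OF assms, of "\<lambda>k. cos_weight k * cos (real k * x)"]
  by (simp add: trig_poly_eq_sum dirichlet_kernel_def mult_ac)

text \<open>After multiplication by \<open>sin\<^sup>2 (x/2)\<close> the Dirichlet kernels become differences of
  cosines of consecutive frequencies, which telescope.\<close>
lemma trig_poly_tent_coeff_closed_form:
  assumes "Q \<le> n + 1"
  shows "2 * (trig_poly n (tent_coeff n Q) x * (sin (x / 2))\<^sup>2)
           = cos ((real n + 1 - real Q) * x) - cos ((real n + 1) * x)"
  using assms
proof (induction Q)
  case 0
  then show ?case by (simp add: trig_poly_tent_coeff)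
next
  case (Suc Q)
  have "2 * (dirichlet_kernel (n - Q) x * (sin (x / 2))\<^sup>2)
      = 2 * sin ((real n - real Q + 1 / 2) * x) * sin (x / 2)"
    using dirichlet_kernel_closed_form[of "n - Q" x] Suc.prems
    by (simp add: power2_eq_square of_nat_diff)
  also have "\<dots> = cos ((real n - real Q) * x) - cos ((real n + 1 - real Q) * x)"
    using cos_add[of "(real n - real Q + 1 / 2) * x" "x / 2"]
      cos_diff[of "(real n - real Q + 1 / 2) * x" "x / 2"]
    by (simp add: algebra_simps)
  finally show ?case
    using Suc by (simp add: trig_poly_tent_coeff algebra_simps)
qed

text \<open>Envelopes meant for \<open>x \<le> 1/(n+1)\<close>, for \<open>1/(n+1) \<le> x \<le> 1/Q\<close>, and for
  \<open>1/Q \<le> x\<close>: they come from the trivial bound for Dirichlet kernels, from \<open>1/sin (x/2)\<close> as a bound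
  for each of the \<open>Q\<close> kernels, and from the telescoped closed form.\<close>
lemma abs_trig_poly_tent_coeff_le:
  fixes x :: real
  assumes Q: "Q \<le> n + 1"
  shows "\<bar>trig_poly n (tent_coeff n Q) x\<bar> \<le> 2 * real Q * (real n + 1)"
    and "0 < x \<Longrightarrow> x \<le> pi \<Longrightarrow> \<bar>trig_poly n (tent_coeff n Q) x\<bar> \<le> real Q * pi / x"
    and "0 < x \<Longrightarrow> x \<le> pi \<Longrightarrow> \<bar>trig_poly n (tent_coeff n Q) x\<bar> \<le> pi\<^sup>2 / x\<^sup>2"
proof -
  let ?V = "\<bar>trig_poly n (tent_coeff n Q) x\<bar>"
  have "?V \<le> (\<Sum>i<Q. \<bar>dirichlet_kernel (n - i) x\<bar>)"
    unfolding trig_poly_tent_coeff[OF Q] by (rule sum_abs)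
  also have "\<dots> \<le> (\<Sum>i<Q. 2 * (real n + 1))"
    by (intro sum_mono order_trans[OF abs_dirichlet_kernel_le]) auto
  finally show "?V \<le> 2 * real Q * (real n + 1)" by (simp add: algebra_simps)
next
  let ?V = "\<bar>trig_poly n (tent_coeff n Q) x\<bar>"
  assume x: "0 < x" "x \<le> pi"
  have sin: "x / pi \<le> sin (x / 2)" using jordan_inequality[of "x / 2"] x by simp
  have xpi: "0 < x / pi" using x by simp
  have "?V \<le> (\<Sum>i<Q. \<bar>dirichlet_kernel (n - i) x\<bar>)"
    unfolding trig_poly_tent_coeff[OF Q] by (rule sum_abs)
  also have "(\<Sum>i<Q. \<bar>dirichlet_kernel (n - i) x\<bar>) \<le> (\<Sum>i<Q. pi / x)"
  proof (rule sum_mono)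
    fix i
    have "\<bar>dirichlet_kernel (n - i) x\<bar> * (x / pi) \<le> \<bar>dirichlet_kernel (n - i) x\<bar> * \<bar>sin (x / 2)\<bar>"
      using sin by (intro mult_left_mono) auto
    also have "\<dots> \<le> 1"
      unfolding abs_mult[symmetric] dirichlet_kernel_closed_form by (rule abs_sin_le_one)
    finally show "\<bar>dirichlet_kernel (n - i) x\<bar> \<le> pi / x"
      using x by (simp add: field_simps)
  qed
  finally show "?V \<le> real Q * pi / x" by simp
  have "?V * (x / pi)\<^sup>2 \<le> ?V * (sin (x / 2))\<^sup>2"
    using sin xpi by (intro mult_left_mono power_mono) auto
  also have "2 * (?V * (sin (x / 2))\<^sup>2) = \<bar>2 * (trig_poly n (tent_coeff n Q) x * (sin (x / 2))\<^sup>2)\<bar>"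
    by (simp add: abs_mult)
  also have "\<dots> \<le> 2"
    unfolding trig_poly_tent_coeff_closed_form[OF Q]
    using abs_cos_le_one[of "(real n + 1 - real Q) * x"] abs_cos_le_one[of "(real n + 1) * x"]
    by linarith
  finally have "?V * (x / pi)\<^sup>2 \<le> 1" by simp
  then show "?V \<le> pi\<^sup>2 / x\<^sup>2"
    using x by (simp add: field_simps)
qed

text \<open>Integrate the three pointwise bounds over \<open>[0, 1/(n+1)]\<close>, \<open>[1/(n+1), 1/Q]\<close> and \<open>[1/Q, \<pi>]\<close>. The first and
  the last piece contribute multiples of \<open>Q\<close>, the middle one the logarithm.\<close>
lemma L1_norm_tent_le:
  assumes Q: "1 \<le> Q" "Q \<le> n + 1"
  shows "L1_norm (trig_poly n (tent_coeff n Q)) \<le> 36 * real Q * (1 + ln ((real n + 1) / real Q))"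
proof -
  let ?V = "\<lambda>x. \<bar>trig_poly n (tent_coeff n Q) x\<bar>" and ?a = "1 / (real n + 1)" and ?b = "1 / real Q"
  have ab: "0 < ?a" "?a \<le> ?b" "?b \<le> pi"
  proof -
    have "?b \<le> 1" using Q by simp
    with pi_ge_two show "?b \<le> pi" by linarith
  qed (use Q in \<open>auto simp: divide_simps\<close>)
  have int: "?V integrable_on {u..v}" for u v
    by (intro integrable_continuous_interval continuous_intros)
  have near: "integral {0..?a} ?V \<le> 2 * real Q"
  proof -
    have "integral {0..?a} ?V \<le> integral {0..?a} (\<lambda>_. 2 * real Q * (real n + 1))"
      using abs_trig_poly_tent_coeff_le(1)[OF Q(2)] by (intro integral_le int) auto
    then show ?thesis by simp
  qed
  have middle: "integral {?a..?b} ?V \<le> real Q * pi * ln ((real n + 1) / real Q)"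
  proof -
    have "((\<lambda>x. real Q * pi / x) has_integral real Q * pi * ln ?b - real Q * pi * ln ?a) {?a..?b}"
      using ab less_le_trans[OF ab(1)] by (intro fundamental_theorem_of_calculus)
        (auto intro!: derivative_eq_intros simp: has_real_derivative_iff_has_vector_derivative[symmetric])
    moreover have "real Q * pi * ln ?b - real Q * pi * ln ?a = real Q * pi * ln ((real n + 1) / real Q)"
      using Q by (simp add: ln_div algebra_simps)
    ultimately have "((\<lambda>x. real Q * pi / x) has_integral real Q * pi * ln ((real n + 1) / real Q)) {?a..?b}"
      by simp
    moreover have "?V x \<le> real Q * pi / x" if "x \<in> {?a..?b}" for x
      using abs_trig_poly_tent_coeff_le(2)[OF Q(2), of x] less_le_trans[OF ab(1), of x] ab(3) that by auto
    ultimately show ?thesis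
      using has_integral_le[OF integrable_integral[OF int]] by blast
  qed
  have far: "integral {?b..pi} ?V \<le> 16 * real Q"
  proof -
    have "((\<lambda>x. pi\<^sup>2 / x\<^sup>2) has_integral (- (pi\<^sup>2 / pi)) - (- (pi\<^sup>2 / ?b))) {?b..pi}"
      using ab by (intro fundamental_theorem_of_calculus)
        (auto intro!: derivative_eq_intros
          simp: has_real_derivative_iff_has_vector_derivative[symmetric] power2_eq_square)
    from has_integral_le[OF integrable_integral[OF int] this]
    have "integral {?b..pi} ?V \<le> (- (pi\<^sup>2 / pi)) - (- (pi\<^sup>2 / ?b))"
      using abs_trig_poly_tent_coeff_le(3)[OF Q(2)] ab by auto
    also have "\<dots> \<le> pi\<^sup>2 * real Q" by simp
    also have "\<dots> \<le> 4\<^sup>2 * real Q"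
      using pi_less_4 by (intro mult_right_mono power_mono) auto
    finally show ?thesis by simp
  qed
  have "integral {0..pi} ?V = integral {0..?a} ?V + integral {?a..?b} ?V + integral {?b..pi} ?V"
    using Henstock_Kurzweil_Integration.integral_combine[OF _ _ int, of 0 ?b pi]
      Henstock_Kurzweil_Integration.integral_combine[OF _ _ int, of 0 ?a ?b] ab by simp
  also have "\<dots> \<le> 2 * real Q + real Q * pi * ln ((real n + 1) / real Q) + 16 * real Q"
    using near middle far by simp
  also have "real Q * pi * ln ((real n + 1) / real Q) \<le> real Q * 4 * ln ((real n + 1) / real Q)"
    using pi_less_4 Q by (intro mult_right_mono mult_left_mono) auto
  also have "2 * real Q + real Q * 4 * ln ((real n + 1) / real Q) + 16 * real Q
      \<le> 18 * (real Q * (1 + ln ((real n + 1) / real Q)))"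
    using Q by (simp add: algebra_simps)
  finally show ?thesis
    using L1_norm_even[of "trig_poly n (tent_coeff n Q)"] trig_poly_even continuous_on_trig_poly by simp
qed


section \<open>The lower estimate\<close>

text \<open>For even \<open>s\<close> all cosines in the derivative have the same sign and modulus \<open>1\<close> at \<open>x = 0\<close>. For odd
  \<open>s\<close> they are all \<open>0\<close> there, but at \<open>x = \<pi>/(2n)\<close> they have a common sign and modulus \<open>sin (k\<pi>/(2n)) \<ge> k/n\<close>. The
  factor \<open>k/n\<close> is harmless, because in the application the sum is dominated by \<open>k\<close> of order \<open>n\<close>.\<close>
lemma sup_norm_iterated_deriv_ge:
  assumes "\<And>k. k \<le> n \<Longrightarrow> 0 \<le> c k" "1 \<le> n"
  shows "ereal (2 * (\<Sum>k\<le>n. c k * real k ^ (s + 1)) / real n) \<le> sup_norm ((deriv ^^ s) (trig_poly n c))"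
proof -
  define x where "x = (if even s then 0 else pi / (2 * real n))"
  define \<epsilon> where "\<epsilon> = (if even s then cos (real s * (pi / 2)) else - sin (real s * (pi / 2)))"
  have phase: "\<bar>\<epsilon>\<bar> \<le> 1" "real k / real n \<le> \<epsilon> * cos (real k * x + real s * (pi / 2))" if "k \<le> n" for k
  proof -
    show "\<bar>\<epsilon>\<bar> \<le> 1" by (simp add: \<epsilon>_def)
    show "real k / real n \<le> \<epsilon> * cos (real k * x + real s * (pi / 2))"
    proof (cases "even s")
      case True
      then obtain m where "s = 2 * m" by blast
      then have "sin (real s * (pi / 2)) = 0" by simp
      then have "\<epsilon> * cos (real k * x + real s * (pi / 2)) = 1"
        using True sin_cos_squared_add[of "real s * (pi / 2)"]
        by (simp add: \<epsilon>_def x_def power2_eq_square)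
      then show ?thesis using that assms(2) by simp
    next
      case False
      then obtain m where "s = 2 * m + 1" using oddE by blast
      then have "cos (real s * (pi / 2)) = cos (real m * pi + pi / 2)" by (simp add: algebra_simps add_divide_distrib)
      then have cos0: "cos (real s * (pi / 2)) = 0" by (simp add: cos_add)
      have "\<epsilon> * cos (real k * x + real s * (pi / 2)) = sin (real k * x) * (sin (real s * (pi / 2)))\<^sup>2"
        using False cos0 by (simp add: \<epsilon>_def cos_add power2_eq_square)
      also have "\<dots> = sin (real k * x)"
        using sin_cos_squared_add[of "real s * (pi / 2)", unfolded cos0] by simp
      also have "\<dots> \<ge> real k / real n"
        using jordan_inequality[of "real k * x"] False that assms(2)
        by (simp add: x_def divide_simps split: if_splits)
      finally show ?thesis .
    qed
  qed
  let ?D = "(deriv ^^ s) (trig_poly n c) x"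
  have "2 * (\<Sum>k\<le>n. c k * real k ^ (s + 1)) / real n
      = (\<Sum>k\<le>n. cos_weight k * c k * real k ^ s * (real k / real n))"
    by (simp add: sum_distrib_left sum_divide_distrib cos_weight_def mult_ac)
       (intro sum.cong; auto)
  also have "\<dots> \<le> (\<Sum>k\<le>n. cos_weight k * c k * real k ^ s * (\<epsilon> * cos (real k * x + real s * (pi / 2))))"
    using assms phase(2)
    by (intro sum_mono mult_left_mono mult_nonneg_nonneg) (auto simp: cos_weight_def)
  also have "\<dots> = \<epsilon> * ?D"
    by (simp add: iterated_deriv_trig_poly sum_distrib_left mult_ac)
  also have "\<dots> \<le> \<bar>\<epsilon>\<bar> * \<bar>?D\<bar>" by (metis abs_ge_self abs_mult)
  also have "\<dots> \<le> \<bar>?D\<bar>" using phase(1)[of 0] by (simp add: mult_left_le_one_le)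
  finally have "ereal (2 * (\<Sum>k\<le>n. c k * real k ^ (s + 1)) / real n) \<le> ereal \<bar>?D\<bar>" by simp
  also have "\<dots> \<le> sup_norm ((deriv ^^ s) (trig_poly n c))"
    unfolding sup_norm_def
  proof (rule SUP_upper)
    have "pi / (2 * real n) \<le> pi" using assms(2) by (simp add: divide_simps)
    then show "x \<in> {- pi..pi}" using order_trans[of "-pi" 0 "pi / (2 * real n)"] by (auto simp: x_def)
  qed
  finally show ?thesis .
qed

text \<open>Close to the distance from \<open>n + 1\<close> at which \<open>k ^ s\<close> drops by a constant factor. The factor \<open>2 * (s + 2)\<close> is
  chosen so that Bernoulli's inequality gives \<open>(1 - Q/(n+1)) ^ (s + 2) \<ge> 1/2\<close> for the
  quotient \<open>Q\<close>; the maximum with \<open>1\<close> takes over when \<open>s\<close> is large compared with \<open>n\<close>.\<close>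
definition tent_width :: "nat \<Rightarrow> nat \<Rightarrow> nat" where
  "tent_width n s = max 1 ((n + 1) div (2 * (s + 2)))"

lemma tent_width_bounds: "1 \<le> tent_width n s" "tent_width n s \<le> n + 1"
  using div_le_dividend[of "n + 1" "2 * (s + 2)"] by (auto simp: tent_width_def simp del: div_le_dividend)

text \<open>If \<open>s\<close> is large compared with \<open>n\<close>, the width is \<open>1\<close> and the term \<open>k = n\<close> suffices. Otherwise
  the sum is one of \<open>Q\<close> power sums up to \<open>n, ..., n - Q + 1\<close>, each of which is at least
  \<open>(n + 1 - Q) ^ (s + 2) / (s + 2)\<close>, and Bernoulli's inequality compares this with
  \<open>n ^ (s + 2) / (s + 2)\<close>.\<close>
lemma sum_tent_coeff_powers_ge:
  "real (tent_width n s) * (real n ^ s + real n ^ (s + 1) / real (s + 1)) * real n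
     \<le> 8 * (\<Sum>k\<le>n. tent_coeff n (tent_width n s) k * real k ^ (s + 1))"
proof -
  let ?Q = "tent_width n s"
  let ?S = "\<Sum>k\<le>n. tent_coeff n ?Q k * real k ^ (s + 1)"
  note Q = tent_width_bounds[of n s]
  show ?thesis
  proof (cases "n + 1 < 2 * (s + 2)")
    case True
    then have Q1: "?Q = 1" by (simp add: tent_width_def)
    have "real n * (real n ^ (s + 1)) \<le> (2 * real s + 2) * (real n ^ (s + 1))"
      using True by (intro mult_right_mono) auto
    then have "real n ^ (s + 2) / real (s + 1) \<le> 2 * real n ^ (s + 1)"
      by (simp add: pos_divide_le_eq algebra_simps)
    then have le: "real ?Q * (real n ^ s + real n ^ (s + 1) / real (s + 1)) * real n \<le> 3 * real n ^ (s + 1)"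
      by (simp add: Q1 algebra_simps)
    have "real n ^ (s + 1) = tent_coeff n ?Q n * real n ^ (s + 1)"
      by (simp add: tent_coeff_def Q1)
    also have "\<dots> \<le> ?S"
      by (rule member_le_sum) (auto simp: tent_coeff_def)
    finally have "real n ^ (s + 1) \<le> ?S" .
    moreover note le
    moreover have "0 \<le> ?S" by (intro sum_nonneg) (auto simp: tent_coeff_def)
    ultimately show ?thesis by linarith
  next
    case False
    then have "1 \<le> (n + 1) div (2 * (s + 2))" by (simp add: Suc_le_eq div_greater_zero_iff)
    then have Qdiv: "?Q * (2 * (s + 2)) \<le> n + 1"
      using div_times_less_eq_dividend[of "n + 1" "2 * (s + 2)"] by (simp add: tent_width_def max_def)
    have "1 / 2 \<le> 1 + real (s + 2) * (- (real ?Q / real (n + 1)))"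
      using of_nat_mono[OF Qdiv, where 'a=real] by (simp add: divide_simps) (simp add: algebra_simps)
    also have "\<dots> \<le> (1 + - (real ?Q / real (n + 1))) ^ (s + 2)"
      using Q by (intro Bernoulli_inequality) (simp add: divide_simps)
    finally have bern: "1 / 2 \<le> (1 + - (real ?Q / real (n + 1))) ^ (s + 2)" .
    have width: "real (n + 1) * (1 + - (real ?Q / real (n + 1))) = real (n + 1 - ?Q)"
      using Q by (simp add: of_nat_diff field_simps)
    from bern have "real (n + 1) ^ (s + 2) * (1 / 2)
        \<le> real (n + 1) ^ (s + 2) * (1 + - (real ?Q / real (n + 1))) ^ (s + 2)"
      by (intro mult_left_mono) auto
    also have "\<dots> = real (n + 1 - ?Q) ^ (s + 2)"
      by (simp only: power_mult_distrib[symmetric] width)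
    finally have half: "real (n + 1) ^ (s + 2) / 2 \<le> real (n + 1 - ?Q) ^ (s + 2)" by simp
    have "real n ^ (s + 2) \<le> real (n + 1) ^ (s + 2)" by (intro power_mono) auto
    with half have half: "real n ^ (s + 2) / 2 \<le> real (n + 1 - ?Q) ^ (s + 2)" by linarith
    have "real ?Q * (real n ^ (s + 2) / 2 / real (s + 2)) = (\<Sum>i<?Q. real n ^ (s + 2) / 2 / real (s + 2))"
      by simp
    also have "\<dots> \<le> (\<Sum>i<?Q. \<Sum>k\<le>n - i. real k ^ (s + 1))"
    proof (rule sum_mono)
      fix i assume "i \<in> {..<?Q}"
      then have "real (n + 1 - ?Q) ^ (s + 2) \<le> real (n - i) ^ (s + 2)"
        by (intro power_mono of_nat_mono) auto
      with half have "real n ^ (s + 2) / 2 / real (s + 2) \<le> real (n - i) ^ (s + 2) / real (s + 2)"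
        by (intro divide_right_mono) auto
      then show "real n ^ (s + 2) / 2 / real (s + 2) \<le> (\<Sum>k\<le>n - i. real k ^ (s + 1))"
        using sum_powers_ge[of "n - i" "s + 1"] by simp
    qed
    also have "\<dots> = ?S" by (rule sum_tent_coeff[OF Q(2), symmetric])
    finally have S: "real ?Q * (real n ^ (s + 2) / 2 / real (s + 2)) \<le> ?S" .
    have sn: "real s + 1 \<le> real n" using False by simp
    have "real n ^ (s + 1) * (real s + 1) \<le> real n ^ (s + 1) * real n"
      by (intro mult_left_mono sn) auto
    then have "real n ^ (s + 1) \<le> real n ^ (s + 2) / real (s + 1)"
      by (simp add: pos_le_divide_eq algebra_simps)
    moreover have "(real n ^ s + real n ^ (s + 1) / real (s + 1)) * real n
        = real n ^ (s + 1) + real n ^ (s + 2) / real (s + 1)"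
      by (simp add: distrib_right)
    ultimately have "(real n ^ s + real n ^ (s + 1) / real (s + 1)) * real n
        \<le> 2 * (real n ^ (s + 2) / real (s + 1))"
      by linarith
    also have "\<dots> \<le> 8 * (real n ^ (s + 2) / 2 / real (s + 2))"
    proof -
      have "real n ^ (s + 2) / real (s + 1) \<le> real n ^ (s + 2) / (real (s + 2) / 2)"
        by (intro divide_left_mono) auto
      moreover have "8 * (a / 2 / b) = 2 * (a / (b / 2))" for a b :: real by simp
      ultimately show ?thesis by (simp only: mult_left_mono zero_le_numeral)
    qed
    finally have "real ?Q * ((real n ^ s + real n ^ (s + 1) / real (s + 1)) * real n)
        \<le> real ?Q * (8 * (real n ^ (s + 2) / 2 / real (s + 2)))"
      by (intro mult_left_mono) auto
    also have "\<dots> = 8 * (real ?Q * (real n ^ (s + 2) / 2 / real (s + 2)))" by simp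
    also have "\<dots> \<le> 8 * ?S" by (intro mult_left_mono S) simp
    finally show ?thesis by (simp only: mult.assoc)
  qed
qed

text \<open>The quotient \<open>(n + 1) / Q\<close> is at most \<open>n + 1\<close> and at most \<open>4 * (s + 2)\<close>, so its logarithm is bounded by
  a multiple of either logarithm on the left.\<close>
lemma tent_norm_factor_times_log_factor_le:
  "(1 / ln (real s + 2) + 1 / ln (real n + 2)) * (1 + ln ((real n + 1) / real (tent_width n s))) \<le> 10"
proof -
  let ?Q = "tent_width n s"
  let ?H = "1 + ln ((real n + 1) / real ?Q)"
  note Q = tent_width_bounds[of n s]
  have pos: "0 < (real n + 1) / real ?Q" using Q by (auto intro!: divide_pos_pos)
  have ln2: "1 \<le> 2 * ln (2::real)"
    using ln2_ge_two_thirds by simp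
  have "ln ((real n + 1) / real ?Q) \<le> ln (real n + 2)"
  proof (subst ln_le_cancel_iff)
    have "(real n + 1) / real ?Q \<le> (real n + 1) / 1" using Q by (intro divide_left_mono) auto
    then show "(real n + 1) / real ?Q \<le> real n + 2" by simp
  qed (use pos in auto)
  moreover have "ln 2 \<le> ln (real n + 2)" by simp
  ultimately have n: "?H \<le> 5 * ln (real n + 2)" using ln2 by linarith
  have "(real n + 1) / real ?Q \<le> 2 ^ 2 * (real s + 2)"
  proof -
    have "n + 1 < 2 * (s + 2) + 2 * (s + 2) * ((n + 1) div (2 * (s + 2)))"
      by (rule dividend_less_times_div) simp
    also have "\<dots> = 2 * (s + 2) * 1 + 2 * (s + 2) * ((n + 1) div (2 * (s + 2)))" by simp
    also have "\<dots> \<le> 2 * (s + 2) * ?Q + 2 * (s + 2) * ?Q"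
      by (intro add_mono mult_le_mono2) (simp_all only: tent_width_def max.cobounded1 max.cobounded2)
    finally have "n + 1 \<le> (4 * (s + 2)) * ?Q" by (simp add: algebra_simps)
    then have "real (n + 1) \<le> real ((4 * (s + 2)) * ?Q)" by (rule of_nat_mono)
    then have "real n + 1 \<le> 2 ^ 2 * (real s + 2) * real ?Q" by (simp add: algebra_simps)
    then show ?thesis using Q by (simp only: pos_divide_le_eq of_nat_0_less_iff)
  qed
  then have "ln ((real n + 1) / real ?Q) \<le> ln (2 ^ 2 * (real s + 2))"
    using pos by (subst ln_le_cancel_iff) auto
  also have "\<dots> = 2 * ln 2 + ln (real s + 2)"
    using ln_realpow[of "2::real" 2] by (subst ln_mult_pos) simp_all
  finally have "ln ((real n + 1) / real ?Q) \<le> 2 * ln 2 + ln (real s + 2)" .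
  moreover have "ln 2 \<le> ln (real s + 2)" by simp
  ultimately have s: "?H \<le> 5 * ln (real s + 2)" using ln2 by linarith
  have "?H / ln (real s + 2) \<le> 5" "?H / ln (real n + 2) \<le> 5"
    using n s by (simp_all add: pos_divide_le_eq)
  then show ?thesis by (simp add: distrib_right)
qed

text \<open>The tent polynomial of width \<open>Q = tent_width n s\<close>, divided by its norm \<open>L\<close>. The norm is
  positive by Hardy's inequality. The constant is \<open>1440 = 4 * 36 * 10\<close>: before normalization the sup norm is at least
  \<open>Q/4\<close> times \<open>n ^ s + n ^ (s + 1) / (s + 1)\<close>, \<open>L\<close> is at most \<open>36 * Q\<close> times its logarithmic factor, and
  that factor times the reciprocals of the logarithms is at most \<open>10\<close>.\<close>
lemma exists_concave_trig_poly_large_deriv: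
  "\<exists>T \<in> concave_trig_polys n. L1_norm T = 1 \<and>
     ereal (1 / 1440 * ((real n ^ s + real n ^ (s + 1) / real (s + 1))
                        * (1 / ln (real s + 2) + 1 / ln (real n + 2))))
       \<le> sup_norm ((deriv ^^ s) T)"
proof -
  let ?Q = "tent_width n s" and ?B = "real n ^ s + real n ^ (s + 1) / real (s + 1)"
    and ?L = "1 / ln (real s + 2) + 1 / ln (real n + 2)"
  let ?c = "tent_coeff n ?Q"
  define L where "L = L1_norm (trig_poly n ?c)"
  note Q = tent_width_bounds[of n s]
  have "0 < (\<Sum>k\<le>n. ?c k / (real n + 1 - real k))"
    using Q by (intro sum_pos) (auto simp: tent_coeff_def)
  then have Lpos: "0 < L"
    using hardy_inequality_trig_poly[of n ?c] unfolding L_def by (force simp: tent_coeff_def)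
  define c where "c = (\<lambda>k. ?c k / L)"
  have conc: "concave_seq n c"
    unfolding c_def by (intro concave_seq_divide concave_seq_tent_coeff Lpos)
  have "trig_poly n c = (\<lambda>x. trig_poly n ?c x / L)"
    by (simp add: fun_eq_iff trig_poly_eq_sum c_def sum_divide_distrib)
  then have norm: "L1_norm (trig_poly n c) = 1"
    using Lpos by (simp add: L1_norm_def[of "\<lambda>x. _ x / L"] L_def[unfolded L1_norm_def, symmetric])
  have "L * ?L \<le> 36 * real ?Q * (1 + ln ((real n + 1) / real ?Q)) * ?L"
    unfolding L_def by (intro mult_right_mono L1_norm_tent_le Q) auto
  also have "\<dots> = 36 * real ?Q * (?L * (1 + ln ((real n + 1) / real ?Q)))" by simp
  also have "\<dots> \<le> 36 * real ?Q * 10"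
    by (intro mult_left_mono tent_norm_factor_times_log_factor_le) auto
  finally have "L * ?L \<le> 360 * real ?Q" by simp
  then have "?L \<le> 360 * real ?Q / L" using Lpos by (simp add: pos_le_divide_eq mult.commute)
  then have "?B * ?L \<le> ?B * (360 * real ?Q / L)" by (intro mult_left_mono) auto
  also have "\<dots> = 1440 * (real ?Q * ?B / 4 / L)" by simp
  finally have "?B * ?L / 1440 \<le> real ?Q * ?B / 4 / L"
    by (simp only: pos_divide_le_eq zero_less_numeral mult.commute)
  then have goal: "1 / 1440 * (?B * ?L) \<le> real ?Q * ?B / 4 / L"
    by (simp only: times_divide_eq_left mult_1)
  have "ereal (real ?Q * ?B / 4 / L) \<le> sup_norm ((deriv ^^ s) (trig_poly n c))"
  proof (cases "n = 0")
    case False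
    have "real ?Q * ?B / 4 \<le> 2 * (\<Sum>k\<le>n. ?c k * real k ^ (s + 1)) / real n"
      using sum_tent_coeff_powers_ge[of n s] False by (simp add: pos_le_divide_eq algebra_simps)
    then have "real ?Q * ?B / 4 / L \<le> 2 * (\<Sum>k\<le>n. ?c k * real k ^ (s + 1)) / real n / L"
      using Lpos by (intro divide_right_mono) auto
    also have "\<dots> = 2 * (\<Sum>k\<le>n. c k * real k ^ (s + 1)) / real n"
      by (simp add: c_def sum_divide_distrib[symmetric] mult.commute)
    finally have "ereal (real ?Q * ?B / 4 / L) \<le> ereal (2 * (\<Sum>k\<le>n. c k * real k ^ (s + 1)) / real n)"
      by simp
    also have "\<dots> \<le> sup_norm ((deriv ^^ s) (trig_poly n c))"
      using concave_seq_nonneg[OF conc] False by (intro sup_norm_iterated_deriv_ge) auto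
    finally show ?thesis .
  next
    case True
    then have "real ?Q * ?B / 4 / L \<le> \<bar>(deriv ^^ s) (trig_poly n c) 0\<bar>"
      using Lpos Q by (cases s) (auto simp: trig_poly_def iterated_deriv_trig_poly cos_weight_def c_def
          tent_coeff_def divide_simps)
    then have "ereal (real ?Q * ?B / 4 / L) \<le> ereal \<bar>(deriv ^^ s) (trig_poly n c) 0\<bar>" by simp
    also have "\<dots> \<le> sup_norm ((deriv ^^ s) (trig_poly n c))"
      unfolding sup_norm_def by (rule SUP_upper) auto
    finally show ?thesis .
  qed
  with goal have "ereal (1 / 1440 * (?B * ?L)) \<le> sup_norm ((deriv ^^ s) (trig_poly n c))"
    by (meson ereal_less_eq(3) order_trans)
  with conc norm show ?thesis unfolding concave_trig_polys_def by blast
qed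

theorem theorem1p4:
  "\<exists>C1>0. \<exists>C2>0. \<forall>n s :: nat.
     (let A = (SUP T\<in>{T \<in> concave_trig_polys n. L1_norm T = 1}. sup_norm ((deriv ^^ s) T));
          B = (real n ^ s + real n ^ (s + 1) / real (s + 1)) *
              (1 / ln (real s + 2) + 1 / ln (real n + 2))
      in ereal (C2 * B) \<le> A \<and> A \<le> ereal (C1 * B))"
proof (intro exI conjI allI)
  fix n s :: nat
  let ?B = "(real n ^ s + real n ^ (s + 1) / real (s + 1)) *
              (1 / ln (real s + 2) + 1 / ln (real n + 2))"
  let ?A = "SUP T\<in>{T \<in> concave_trig_polys n. L1_norm T = 1}. sup_norm ((deriv ^^ s) T)"
  have "ereal (1 / 1440 * ?B) \<le> ?A"
    using exists_concave_trig_poly_large_deriv[of n s] by (auto intro: SUP_upper2)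
  moreover have "?A \<le> ereal (8 * ?B)"
  proof (rule SUP_least)
    fix T assume "T \<in> {T \<in> concave_trig_polys n. L1_norm T = 1}"
    then obtain c where "T = trig_poly n c" "concave_seq n c" "L1_norm (trig_poly n c) = 1"
      by (auto simp: concave_trig_polys_def)
    then show "sup_norm ((deriv ^^ s) T) \<le> ereal (8 * ?B)"
      using sup_norm_iterated_deriv_le[of n c s] by (simp only: mult.assoc mult_1_right)
  qed
  ultimately show "let A = ?A; B = ?B in ereal (1 / 1440 * B) \<le> A \<and> A \<le> ereal (8 * B)"
    unfolding Let_def by blast
qed auto

end
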